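(* Let $B$ be a non-trivial Boolean algebra and let $\mathscr K_{\max}=\{M\subseteq B: M\neq\emptyset,\ 0\notin M\}$. Then $\mathscr K_{\max}$ is an ultracontact on $B$, and $\mathscr K\subseteq\mathscr K_{\max}$ for every ultracontact $\mathscr K$ on $B$.
   Context: Let $B$ be a non-trivial Boolean algebra with order $\le$ and join $+$. For $F,G\subseteq B$ put $F+G=\{f+g: f\in F,\ g\in G\}$, and write $F\preceq G$ iff for every $g\in G$ there is $f\in F$ with $f\le g$. An ultracontact on $B$ is a family $\mathscr K\subseteq 2^B$ such that for all $F,G\subseteq B$: (K0) $\emptyset\notin\mathscr K$; (K1) if $0\in F$ then $F\notin\mathscr K$; (K2) if $x\neq 0$ then $\{x\}\in\mathscr K$; (K3) if $F\preceq G$, $G\neq\emptyset$ and $F\in\mathscr K$, then $G\in\mathscr K$; (K4) if $F+G\in\mathscr K$ then $F\in\mathscr K$ or $G\in\mathscr K$. *)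

theory Defs
  imports Main
begin

text \<open>
  The Boolean algebra is the type class \<^class>\<open>boolean_algebra\<close>: its join is \<^const>\<open>sup\<close>,
  its zero is \<^const>\<open>bot\<close>. The class admits the one-element algebra, so non-triviality
  (\<^prop>\<open>bot \<noteq> top\<close>) has to be assumed explicitly where it is wanted.
\<close>

definition join_sets :: "'a::boolean_algebra set \<Rightarrow> 'a set \<Rightarrow> 'a set" where
  "join_sets F G = {sup f g | f g. f \<in> F \<and> g \<in> G}"

definition refines :: "'a::boolean_algebra set \<Rightarrow> 'a set \<Rightarrow> bool" (infix \<open>\<preceq>\<close> 50) where
  "F \<preceq> G \<longleftrightarrow> (\<forall>g\<in>G. \<exists>f\<in>F. f \<le> g)"

definition ultracontact :: "'a::boolean_algebra set set \<Rightarrow> bool" where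
  "ultracontact K \<longleftrightarrow>
     {} \<notin> K \<and>
     (\<forall>F. bot \<in> F \<longrightarrow> F \<notin> K) \<and>
     (\<forall>x. x \<noteq> bot \<longrightarrow> {x} \<in> K) \<and>
     (\<forall>F G. F \<preceq> G \<and> G \<noteq> {} \<and> F \<in> K \<longrightarrow> G \<in> K) \<and>
     (\<forall>F G. join_sets F G \<in> K \<longrightarrow> F \<in> K \<or> G \<in> K)"

definition K_max :: "'a::boolean_algebra set set" where
  "K_max = {M. M \<noteq> {} \<and> bot \<notin> M}"

end

theory Submission
  imports Defs
begin

text \<open>(K0) and (K1) say precisely that every ultracontact lies inside \<open>K_max\<close>.
  For \<open>K_max\<close> itself the work is in (K3) and (K4), and both rest on \<open>bot\<close>
  being least: only \<open>bot\<close> lies below \<open>bot\<close>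
  (\<open>bot_in_refining\<close>), and a join is \<open>bot\<close> only if both arguments are
  (\<open>bot_in_join_sets_iff\<close>).\<close>

lemma bot_in_refining:
  assumes "F \<preceq> G" and "bot \<in> G"
  shows "bot \<in> F"
  using assms by (auto simp: refines_def bot_unique)

lemma bot_in_join_sets_iff: "bot \<in> join_sets F G \<longleftrightarrow> bot \<in> F \<and> bot \<in> G"
proof -
  \<comment> \<open>Membership in the comprehension unfolds to this orientation, the mirror image of
    \<open>sup_eq_bot_iff\<close>.\<close>
  have "bot = sup f g \<longleftrightarrow> f = bot \<and> g = bot" for f g :: 'a
    using sup_eq_bot_iff[of f g] by auto
  then show ?thesis
    by (simp add: join_sets_def)
qed

lemma join_sets_eq_empty_iff: "join_sets F G = {} \<longleftrightarrow> F = {} \<or> G = {}"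
  by (auto simp: join_sets_def)

text \<open>For (K4), a join set in \<open>K_max\<close> forces both \<open>F\<close> and
  \<open>G\<close> to be nonempty and at least one of them to avoid \<open>bot\<close>; that one is
  in \<open>K_max\<close>.\<close>

lemma ultracontact_K_max: "ultracontact K_max"
  unfolding ultracontact_def K_max_def
  by (auto simp: bot_in_join_sets_iff join_sets_eq_empty_iff dest: bot_in_refining)

lemma ultracontact_subset_K_max:
  assumes "ultracontact K"
  shows "K \<subseteq> K_max"
  using assms unfolding ultracontact_def K_max_def by blast

theorem theorem4p5:
  assumes "(bot :: 'a::boolean_algebra) \<noteq> top"
  shows "ultracontact (K_max :: 'a set set) \<and>
         (\<forall>K :: 'a set set. ultracontact K \<longrightarrow> K \<subseteq> K_max)"
  using ultracontact_K_max ultracontact_subset_K_max by blast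

end
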